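(* Consider a run of Algorithm BCD (described in the context) applied to the minimization of $f(\boldsymbol{x}_1,\dots,\boldsymbol{x}_{n_{\mathrm{blocks}}})$ subject to $\boldsymbol{x}_i\in\Omega_i$, $i=1,\dots,n_{\mathrm{blocks}}$. Assume that the Lipschitz assumption, the bounded-Hessian assumption, the lower-boundedness assumption and the block-choice assumption stated in the context hold (with constants $\gamma$, $c_B$, $m$), and that for all $k\in\mathbb{N}$ the computation of $j_k$ and $\boldsymbol{x}_{i_k}^{\mathrm{trial}}$ at Step 2 is possible. For $i\in\{1,\dots,n_{\mathrm{blocks}}\}$ and $k\ge m$, define $o(i,k):=j_{\hat k}$, where $\hat k$ is the latest iteration (not larger than $k$) at which $i_{\hat k}=i$, and let $\mu_{i,o(i,k),\ell}$, $\ell=1,\dots,n_{\mathrm g}(i,o(i,k))$, be the multipliers associated in Step 2 of iteration $\hat k$ with the accepted trial point $\boldsymbol{x}_i^{\hat k+1}$. Then, for $i\in\{1,\dots,n_{\mathrm{blocks}}\}$ and $k\ge m$, we have that $\mu_{i,o(i,k),\ell}\ge 0$ for $\ell=1,\dots,n_{\mathrm g}(i,o(i,k))$, \[ \boldsymbol{x}_i^{k+1}\in A_{i,o(i,k)}, \] \[ \min\{\mu_{i,o(i,k),\ell},\,-g_{i,o(i,k),\ell}(\boldsymbol{x}_i^{k+1})\}\le\delta,\quad \ell=1,\dots,n_{\mathrm g}(i,o(i,k)), \] and \[ \lim_{k\to\infty}\left\|\nabla_i f(x^{k+1})+\sum_{\ell=1}^{n_{\mathrm g}(i,o(i,k))}\mu_{i,o(i,k),\ell}\nabla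 g_{i,o(i,k),\ell}(\boldsymbol{x}_i^{k+1})\right\|=0. \] Moreover, given $\varepsilon>0$, the number of iterations at which \[ \left\|\nabla_i f(x^{k+1})+\sum_{\ell=1}^{n_{\mathrm g}(i,o(i,k))}\mu_{i,o(i,k),\ell}\nabla g_{i,o(i,k),\ell}(\boldsymbol{x}_i^{k+1})\right\|>\varepsilon \] is bounded above by \[ \frac{f(x^0)-f_{\mathrm{bound}}}{\alpha\,(\varepsilon/(c_4 m))^2}, \] where $f_{\mathrm{bound}}$ is an arbitrary lower bound of $\{f(x^k)\}$, $c_4:=c_B+\sigma_{\max}+\theta+\gamma$ and $\sigma_{\max}:=2(\gamma+c_B+2\alpha)$.
   Context: Notation. $\|\cdot\|$ is the Euclidean norm (and the induced matrix norm), $\mathbb{N}=\{0,1,2,\dots\}$. $f:\mathbb{R}^n\to\mathbb{R}$ is smooth, $n=\sum_{i=1}^{n_{\mathrm{blocks}}}n_i$ with $n_i\ge1$, and $x\in\mathbb{R}^n$ is written in blocks $x=(\boldsymbol{x}_1,\dots,\boldsymbol{x}_{n_{\mathrm{blocks}}})$, $\boldsymbol{x}_i\in\mathbb{R}^{n_i}$; $\nabla_i$ is the gradient with respect to the $i$th block. We write $f(x)=f(\boldsymbol{x}_1,\dots,\boldsymbol{x}_{n_{\mathrm{blocks}}})$. Feasible sets. For each $i=1,\dots,n_{\mathrm{blocks}}$, $\Omega_i\subset\mathbb{R}^{n_i}$ is closed and bounded, and there are open sets $A_{i,j}$, $j=1,\dots,n_{\mathrm{ops}}(i)$, with $\Omega_i\subset\bigcup_{j}A_{i,j}$,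 and smooth functions $g_{i,j,\ell}:A_{i,j}\to\mathbb{R}$, $\ell=1,\dots,n_{\mathrm g}(i,j)$, such that $\Omega_i\cap A_{i,j}=\{\boldsymbol{x}_i\in A_{i,j}: g_{i,j,\ell}(\boldsymbol{x}_i)\le0,\ \ell=1,\dots,n_{\mathrm g}(i,j)\}$. Algorithm BCD. Given $\alpha>0$, $\delta\ge0$, $\theta>0$, $\sigma_{\min}>0$ and $\boldsymbol{x}_i^0\in\Omega_i$ for all $i$; set $k\leftarrow0$. Step 1. Set $\sigma\leftarrow0$, choose $i_k\in\{1,\dots,n_{\mathrm{blocks}}\}$ and a symmetric matrix $B_k\in\mathbb{R}^{n_{i_k}\times n_{i_k}}$. Step 2. Find $j_k\in\{1,\dots,n_{\mathrm{ops}}(i_k)\}$ and $\boldsymbol{x}_{i_k}^{\mathrm{trial}}\in A_{i_k,j_k}$ such that, if $\sigma>0$, Alternative 1 holds, and, if $\sigma=0$, Alternative 1 or Alternative 2 holds. Put $s=\boldsymbol{x}_{i_k}^{\mathrm{trial}}-\boldsymbol{x}_{i_k}^k$. Alternative 1: $\nabla_{i_k}f(x^k)^Ts+\frac12 s^TB_ks+\frac{\sigma}{2}\|s\|^2\le0$ and there exist $\mu_{i_k,j_k,\ell}\ge0$, $\ell=1,\dots,n_{\mathrm g}(i_k,j_k)$, with $\left\|\nabla_{i_k}f(x^k)+B_ks+\sigma s+\sum_{\ell}\mu_{i_k,j_k,\ell}\nabla g_{i_k,j_k,\ell}(\boldsymbol{x}_{i_k}^{\mathrm{trial}})\right\|\le\theta\|s\|$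 and $\min\{\mu_{i_k,j_k,\ell},-g_{i_k,j_k,\ell}(\boldsymbol{x}_{i_k}^{\mathrm{trial}})\}\le\delta$ for all $\ell$. Alternative 2: there exist $\mu_{i_k,j_k,\ell}\ge0$, $\ell=1,\dots,n_{\mathrm g}(i_k,j_k)$, with $\left\|\nabla_{i_k}f(\boldsymbol{x}_1^k,\dots,\boldsymbol{x}_{i_k}^{\mathrm{trial}},\dots,\boldsymbol{x}_{n_{\mathrm{blocks}}}^k)+\sum_\ell\mu_{i_k,j_k,\ell}\nabla g_{i_k,j_k,\ell}(\boldsymbol{x}_{i_k}^{\mathrm{trial}})\right\|=0$ and $\min\{\mu_{i_k,j_k,\ell},-g_{i_k,j_k,\ell}(\boldsymbol{x}_{i_k}^{\mathrm{trial}})\}\le0$ for all $\ell$. Step 3. Test the sufficient descent condition $f(\boldsymbol{x}_1^k,\dots,\boldsymbol{x}_{i_k}^{\mathrm{trial}},\dots,\boldsymbol{x}_{n_{\mathrm{blocks}}}^k)\le f(x^k)-\alpha\|\boldsymbol{x}_{i_k}^{\mathrm{trial}}-\boldsymbol{x}_{i_k}^k\|^2$. If it holds, define $\sigma_k=\sigma$, $\boldsymbol{x}_{i_k}^{k+1}=\boldsymbol{x}_{i_k}^{\mathrm{trial}}$, $\boldsymbol{x}_i^{k+1}=\boldsymbol{x}_i^k$ for $i\ne i_k$, set $k\leftarrow k+1$ and go to Step 1. Otherwise set $\sigma\leftarrow\max\{\sigma_{\min},2\sigma\}$ and go to Step 2 (so $j_k$, the trial point and the multipliers are recomputed; after acceptance,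 $j_k$ and the multipliers of iteration $k$ denote those of the accepted trial point). Lipschitz assumption. There is $\gamma>0$ such that for all $\boldsymbol{x}_{i_k}^k$ and $\boldsymbol{x}_{i_k}^{\mathrm{trial}}$ computed by the algorithm, $\|\nabla_{i_k}f(x^k)-\nabla_{i_k}f(\boldsymbol{x}_1^k,\dots,\boldsymbol{x}_{i_k}^{\mathrm{trial}},\dots,\boldsymbol{x}_{n_{\mathrm{blocks}}}^k)\|\le\gamma\|\boldsymbol{x}_{i_k}^k-\boldsymbol{x}_{i_k}^{\mathrm{trial}}\|$ and $f(\boldsymbol{x}_1^k,\dots,\boldsymbol{x}_{i_k}^{\mathrm{trial}},\dots,\boldsymbol{x}_{n_{\mathrm{blocks}}}^k)\le f(x^k)+\nabla_{i_k}f(x^k)^T(\boldsymbol{x}_{i_k}^{\mathrm{trial}}-\boldsymbol{x}_{i_k}^k)+\frac{\gamma}{2}\|\boldsymbol{x}_{i_k}^k-\boldsymbol{x}_{i_k}^{\mathrm{trial}}\|^2$; moreover, if $x^{k_1}$ differs from $x^{k_2}$ in only one block $i_{\mathrm{diff}}$, then $\|\nabla_if(x^{k_1})-\nabla_if(x^{k_2})\|\le\gamma\|\boldsymbol{x}_{i_{\mathrm{diff}}}^{k_2}-\boldsymbol{x}_{i_{\mathrm{diff}}}^{k_1}\|$ for all $i=1,\dots,n_{\mathrm{blocks}}$. Bounded-Hessian assumption. There is $c_B>0$ such that $\|B_k\|\le c_B$ for all $k\in\mathbb{N}$. Lower-boundedness assumption. The sequence $\{f(x^k)\}$ is bounded below.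 Block-choice assumption. There is $m\in\{1,2,\dots\}$ such that, for all $\nu\in\{1,\dots,n_{\mathrm{blocks}}\}$, $i_k=\nu$ infinitely many times and, if $k_1<k_2<k_3<\dots$ are all the iteration indices $k$ with $i_k=\nu$, then $k_1\le m$ and $k_{j+1}-k_j\le m$ for all $j=1,2,3,\dots$.
   Formalization: The iteration bound with c_4 as stated is proved only when σ_min ≤ σ_max, since it can fail otherwise (an accepted σ_k may equal σ_min); in general the bound is proved with max{σ_min, σ_max} in place of σ_max in c_4. *)

theory Defs
  imports "HOL-Analysis.Analysis" "HOL-Library.Infinite_Set"
begin

(* The blocks partition the coordinates of R^n: b c is the number of the block that coordinate c
   belongs to, and R^{n_i} is represented, isometrically, by the coordinate subspace of real ^ 'n
   of the vectors that vanish outside block i. *)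

definition block_space :: "('n \<Rightarrow> nat) \<Rightarrow> nat \<Rightarrow> (real ^ 'n) set" where
  "block_space b i = {v. \<forall>c. b c \<noteq> i \<longrightarrow> v $ c = 0}"

definition block_part :: "('n \<Rightarrow> nat) \<Rightarrow> nat \<Rightarrow> real ^ 'n \<Rightarrow> real ^ 'n" where
  "block_part b i x = (\<chi> c. if b c = i then x $ c else 0)"

definition block_upd :: "('n \<Rightarrow> nat) \<Rightarrow> nat \<Rightarrow> real ^ 'n \<Rightarrow> real ^ 'n \<Rightarrow> real ^ 'n" where
  "block_upd b i x y = (\<chi> c. if b c = i then y $ c else x $ c)"

(* An n_i x n_i matrix, padded with zeros; its operator norm on the whole space is the one it
   has on the block. *)
definition block_matrix :: "('n \<Rightarrow> nat) \<Rightarrow> nat \<Rightarrow> real ^ 'n ^ 'n \<Rightarrow> bool" where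
  "block_matrix b i B \<longleftrightarrow> (\<forall>c d. b c \<noteq> i \<or> b d \<noteq> i \<longrightarrow> B $ c $ d = 0)"

(* The gradient at y of a function of which only the values on the subspace V matter. *)
definition gradient_in :: "'a::real_inner set \<Rightarrow> ('a \<Rightarrow> real) \<Rightarrow> 'a \<Rightarrow> 'a" where
  "gradient_in V h y = (THE v. v \<in> V \<and> (h has_derivative (\<lambda>d. v \<bullet> d)) (at y within V))"

(* "Smooth" is read as continuously differentiable, which covers infinitely differentiable
   functions. A is meant to be open relative to V. *)
definition smooth_in :: "'a::real_inner set \<Rightarrow> 'a set \<Rightarrow> ('a \<Rightarrow> real) \<Rightarrow> bool" where
  "smooth_in V A h \<longleftrightarrow>
     (\<forall>y\<in>A. \<exists>v\<in>V. (h has_derivative (\<lambda>d. v \<bullet> d)) (at y within V)) \<and>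
     continuous_on A (gradient_in V h)"

definition block_gradient ::
    "('n::finite \<Rightarrow> nat) \<Rightarrow> nat \<Rightarrow> (real ^ 'n \<Rightarrow> real) \<Rightarrow> real ^ 'n \<Rightarrow> real ^ 'n" where
  "block_gradient b i f x =
     gradient_in (block_space b i) (\<lambda>y. f (block_upd b i x y)) (block_part b i x)"

lemma block_part_in: "block_part b i x \<in> block_space b i"
  by (simp add: block_part_def block_space_def)

lemma block_part_id: "v \<in> block_space b i \<Longrightarrow> block_part b i v = v"
  by (auto simp: block_part_def block_space_def vec_eq_iff)

lemma bounded_linear_block_part: "bounded_linear (block_part b i :: real ^ 'n \<Rightarrow> real ^ 'n)"
  by (rule linear_conv_bounded_linear[THEN iffD1], rule linearI)
     (auto simp: block_part_def vec_eq_iff)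

lemma gradient_in_block_eqI:
  fixes h :: "real ^ 'n \<Rightarrow> real"
  assumes y: "y \<in> block_space b i" and v: "v \<in> block_space b i"
    and h: "(h has_derivative (\<lambda>d. v \<bullet> d)) (at y within block_space b i)"
  shows "gradient_in (block_space b i) h y = v"
proof -
  have ext: "((\<lambda>z. h (block_part b i z)) has_derivative (\<lambda>d. w \<bullet> block_part b i d)) (at y)"
    if "(h has_derivative (\<lambda>d. w \<bullet> d)) (at y within block_space b i)" for w
  proof -
    have "(block_part b i has_derivative block_part b i) (at y)"
      by (rule bounded_linear_imp_has_derivative[OF bounded_linear_block_part])
    moreover have "(h has_derivative (\<lambda>d. w \<bullet> d)) (at (block_part b i y) within range (block_part b i))"
      unfolding block_part_id[OF y]
      by (rule has_derivative_subset[OF that]) (auto intro: block_part_in)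
    ultimately show ?thesis
      using has_derivative_in_compose[of "block_part b i" "block_part b i" y UNIV h "\<lambda>d. w \<bullet> d"]
      by simp
  qed
  show ?thesis
    unfolding gradient_in_def
  proof (rule the_equality)
    fix w assume w: "w \<in> block_space b i \<and>
      (h has_derivative (\<lambda>d. w \<bullet> d)) (at y within block_space b i)"
    have "(\<lambda>d. w \<bullet> block_part b i d) = (\<lambda>d. v \<bullet> block_part b i d)"
      using has_derivative_unique[OF ext ext[OF h]] w by blast
    then have "w \<bullet> block_part b i (w - v) = v \<bullet> block_part b i (w - v)"
      by meson
    moreover have "w - v \<in> block_space b i"
      using v w by (simp add: block_space_def)
    ultimately have "(w - v) \<bullet> (w - v) = 0"
      by (simp add: block_part_id inner_diff_left)
    then show "w = v" by simp
  qed (use v h in simp)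
qed

lemma block_gradient_eq:
  fixes f :: "real ^ 'n \<Rightarrow> real"
  assumes "(f has_derivative (\<lambda>d. D \<bullet> d)) (at x)"
  shows "block_gradient b i f x = block_part b i D"
proof -
  let ?u = "block_upd b i x" and ?p = "block_part b i" and ?V = "block_space b i"
  have u: "?u = (\<lambda>y. (x - ?p x) + ?p y)"
    by (auto simp: block_upd_def block_part_def vec_eq_iff)
  have "(?u has_derivative ?p) (at (?p x) within ?V)"
    unfolding u
    by (rule has_derivative_eq_rhs[OF has_derivative_add[OF has_derivative_const
          bounded_linear_imp_has_derivative[OF bounded_linear_block_part]]]) simp
  moreover have "?u (?p x) = x"
    by (auto simp: block_upd_def block_part_def vec_eq_iff)
  ultimately have "((\<lambda>y. f (?u y)) has_derivative (\<lambda>d. D \<bullet> ?p d)) (at (?p x) within ?V)"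
    using has_derivative_compose[of ?u ?p "?p x" ?V f "\<lambda>d. D \<bullet> d"] assms by simp
  moreover have "D \<bullet> ?p d = ?p D \<bullet> d" for d
    by (auto simp: inner_vec_def block_part_def intro!: sum.cong)
  ultimately show ?thesis
    unfolding block_gradient_def
    by (intro gradient_in_block_eqI) (auto intro: block_part_in)
qed

(* cover P i j is the open set A_{i,j}, and con P i j l is the function g_{i,j,l}, of which only
   the values on cover P i j matter. *)
record ('n::finite) bcd_problem =
  block_of :: "'n \<Rightarrow> nat"
  nblocks :: nat
  obj :: "real ^ 'n \<Rightarrow> real"
  feas :: "nat \<Rightarrow> (real ^ 'n) set"
  nops :: "nat \<Rightarrow> nat"
  cover :: "nat \<Rightarrow> nat \<Rightarrow> (real ^ 'n) set"
  ncons :: "nat \<Rightarrow> nat \<Rightarrow> nat"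
  con :: "nat \<Rightarrow> nat \<Rightarrow> nat \<Rightarrow> real ^ 'n \<Rightarrow> real"

abbreviation bspace :: "('n::finite) bcd_problem \<Rightarrow> nat \<Rightarrow> (real ^ 'n) set" where
  "bspace P \<equiv> block_space (block_of P)"

abbreviation bpart :: "('n::finite) bcd_problem \<Rightarrow> nat \<Rightarrow> real ^ 'n \<Rightarrow> real ^ 'n" where
  "bpart P \<equiv> block_part (block_of P)"

abbreviation bupd :: "('n::finite) bcd_problem \<Rightarrow> nat \<Rightarrow> real ^ 'n \<Rightarrow> real ^ 'n \<Rightarrow> real ^ 'n" where
  "bupd P \<equiv> block_upd (block_of P)"

abbreviation grad_obj :: "('n::finite) bcd_problem \<Rightarrow> nat \<Rightarrow> real ^ 'n \<Rightarrow> real ^ 'n" where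
  "grad_obj P i \<equiv> block_gradient (block_of P) i (obj P)"

abbreviation grad_con ::
    "('n::finite) bcd_problem \<Rightarrow> nat \<Rightarrow> nat \<Rightarrow> nat \<Rightarrow> real ^ 'n \<Rightarrow> real ^ 'n" where
  "grad_con P i j l \<equiv> gradient_in (bspace P i) (con P i j l)"

(* Surjectivity of block_of onto the block numbers says that every n_i is at least 1. *)
definition bcd_problem :: "('n::finite) bcd_problem \<Rightarrow> bool" where
  "bcd_problem P \<longleftrightarrow>
     range (block_of P) = {1..nblocks P} \<and>
     smooth_in UNIV UNIV (obj P) \<and>
     (\<forall>i\<in>{1..nblocks P}.
        feas P i \<subseteq> bspace P i \<and> closed (feas P i) \<and> bounded (feas P i) \<and>
        feas P i \<subseteq> (\<Union>j\<in>{1..nops P i}. cover P i j) \<and>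
        (\<forall>j\<in>{1..nops P i}.
           openin (top_of_set (bspace P i)) (cover P i j) \<and>
           (\<forall>l\<in>{1..ncons P i j}. smooth_in (bspace P i) (cover P i j) (con P i j l)) \<and>
           feas P i \<inter> cover P i j
             = {y \<in> cover P i j. \<forall>l\<in>{1..ncons P i j}. con P i j l y \<le> 0}))"

(* The left-hand side inside the norms of the approximate stationarity conditions:
   G + sum_l mu_l * grad g_{i,j,l}(y). *)
definition lagr :: "('n::finite) bcd_problem \<Rightarrow> nat \<Rightarrow> nat \<Rightarrow> (nat \<Rightarrow> real)
    \<Rightarrow> real ^ 'n \<Rightarrow> real ^ 'n \<Rightarrow> real ^ 'n" where
  "lagr P i j \<mu> y G = G + (\<Sum>l\<in>{1..ncons P i j}. \<mu> l *\<^sub>R grad_con P i j l y)"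

definition alternative1 where
  "alternative1 P \<delta> \<theta> \<sigma> i B x j y \<mu> \<longleftrightarrow>
     (let s = y - bpart P i x in
        grad_obj P i x \<bullet> s + 1/2 * (s \<bullet> (B *v s)) + \<sigma>/2 * (norm s)\<^sup>2 \<le> 0 \<and>
        (\<forall>l\<in>{1..ncons P i j}. \<mu> l \<ge> 0) \<and>
        norm (lagr P i j \<mu> y (grad_obj P i x + B *v s + \<sigma> *\<^sub>R s)) \<le> \<theta> * norm s \<and>
        (\<forall>l\<in>{1..ncons P i j}. min (\<mu> l) (- con P i j l y) \<le> \<delta>))"

definition alternative2 where
  "alternative2 P i x j y \<mu> \<longleftrightarrow>
     (\<forall>l\<in>{1..ncons P i j}. \<mu> l \<ge> 0) \<and>
     norm (lagr P i j \<mu> y (grad_obj P i (bupd P i x y))) = 0 \<and>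
     (\<forall>l\<in>{1..ncons P i j}. min (\<mu> l) (- con P i j l y) \<le> 0)"

(* The r-th execution of Step 2 (r = 0, 1, ...) within iteration k finds op R k r, trial R k r and
   the multipliers mult R k r l. Entries with r beyond the accepted attempt are meaningless. *)
record ('n::finite) bcd_run =
  iter :: "nat \<Rightarrow> real ^ 'n"
  blk :: "nat \<Rightarrow> nat"
  hess :: "nat \<Rightarrow> real ^ 'n ^ 'n"
  op :: "nat \<Rightarrow> nat \<Rightarrow> nat"
  trial :: "nat \<Rightarrow> nat \<Rightarrow> real ^ 'n"
  mult :: "nat \<Rightarrow> nat \<Rightarrow> nat \<Rightarrow> real"

primrec reg :: "real \<Rightarrow> nat \<Rightarrow> real" where
  "reg \<sigma>min 0 = 0"
| "reg \<sigma>min (Suc r) = max \<sigma>min (2 * reg \<sigma>min r)"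

definition trial_point :: "('n::finite) bcd_problem \<Rightarrow> 'n bcd_run \<Rightarrow> nat \<Rightarrow> nat \<Rightarrow> real ^ 'n" where
  "trial_point P R k r = bupd P (blk R k) (iter R k) (trial R k r)"

definition descent where
  "descent P \<alpha> R k r \<longleftrightarrow>
     obj P (trial_point P R k r)
       \<le> obj P (iter R k) - \<alpha> * (norm (trial R k r - bpart P (blk R k) (iter R k)))\<^sup>2"

(* The algorithm computes the r-th trial of iteration k iff it rejected all earlier ones. *)
definition attempted where
  "attempted P \<alpha> R k r \<longleftrightarrow> (\<forall>r'<r. \<not> descent P \<alpha> R k r')"

definition accepted where
  "accepted P \<alpha> R k = (LEAST r. descent P \<alpha> R k r)"

(* Step 2 is required to succeed whenever it is executed. That the loop between Steps 2 and 3
   ends is not part of the definition. *)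
definition bcd_run ::
    "('n::finite) bcd_problem \<Rightarrow> real \<Rightarrow> real \<Rightarrow> real \<Rightarrow> real \<Rightarrow> 'n bcd_run \<Rightarrow> bool" where
  "bcd_run P \<alpha> \<delta> \<theta> \<sigma>min R \<longleftrightarrow>
     (\<forall>i\<in>{1..nblocks P}. bpart P i (iter R 0) \<in> feas P i) \<and>
     (\<forall>k. blk R k \<in> {1..nblocks P} \<and>
          block_matrix (block_of P) (blk R k) (hess R k) \<and> transpose (hess R k) = hess R k) \<and>
     (\<forall>k r. attempted P \<alpha> R k r \<longrightarrow>
        op R k r \<in> {1..nops P (blk R k)} \<and>
        trial R k r \<in> cover P (blk R k) (op R k r) \<and>
        (alternative1 P \<delta> \<theta> (reg \<sigma>min r) (blk R k) (hess R k) (iter R k)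
           (op R k r) (trial R k r) (mult R k r) \<or>
         reg \<sigma>min r = 0 \<and>
         alternative2 P (blk R k) (iter R k) (op R k r) (trial R k r) (mult R k r))) \<and>
     (\<forall>k r. attempted P \<alpha> R k r \<and> descent P \<alpha> R k r \<longrightarrow> iter R (Suc k) = trial_point P R k r)"

definition lipschitz_assm ::
    "('n::finite) bcd_problem \<Rightarrow> real \<Rightarrow> 'n bcd_run \<Rightarrow> real \<Rightarrow> bool" where
  "lipschitz_assm P \<alpha> R \<gamma> \<longleftrightarrow>
     (\<forall>k r. attempted P \<alpha> R k r \<longrightarrow>
        (let i = blk R k; xi = bpart P i (iter R k); y = trial R k r in
           norm (grad_obj P i (iter R k) - grad_obj P i (trial_point P R k r))
             \<le> \<gamma> * norm (xi - y) \<and>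
           obj P (trial_point P R k r)
             \<le> obj P (iter R k) + grad_obj P i (iter R k) \<bullet> (y - xi)
                + \<gamma>/2 * (norm (xi - y))\<^sup>2)) \<and>
     (\<forall>k1 k2. \<forall>d\<in>{1..nblocks P}.
        bpart P d (iter R k1) \<noteq> bpart P d (iter R k2) \<and>
        (\<forall>i\<in>{1..nblocks P}. i \<noteq> d \<longrightarrow> bpart P i (iter R k1) = bpart P i (iter R k2)) \<longrightarrow>
        (\<forall>i\<in>{1..nblocks P}.
           norm (grad_obj P i (iter R k1) - grad_obj P i (iter R k2))
             \<le> \<gamma> * norm (bpart P d (iter R k2) - bpart P d (iter R k1))))"

definition bounded_hessian_assm :: "('n::finite) bcd_run \<Rightarrow> real \<Rightarrow> bool" where
  "bounded_hessian_assm R cB \<longleftrightarrow> (\<forall>k. onorm ((*v) (hess R k)) \<le> cB)"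

definition lower_bounded_assm :: "('n::finite) bcd_problem \<Rightarrow> 'n bcd_run \<Rightarrow> bool" where
  "lower_bounded_assm P R \<longleftrightarrow> bdd_below (range (\<lambda>k. obj P (iter R k)))"

definition block_choice_assm :: "('n::finite) bcd_problem \<Rightarrow> 'n bcd_run \<Rightarrow> nat \<Rightarrow> bool" where
  "block_choice_assm P R m \<longleftrightarrow>
     (\<forall>\<nu>\<in>{1..nblocks P}.
        infinite {k. blk R k = \<nu>} \<and>
        enumerate {k. blk R k = \<nu>} 0 \<le> m \<and>
        (\<forall>j. enumerate {k. blk R k = \<nu>} (Suc j) - enumerate {k. blk R k = \<nu>} j \<le> m))"

definition last_iter :: "('n::finite) bcd_run \<Rightarrow> nat \<Rightarrow> nat \<Rightarrow> nat" where
  "last_iter R i k = Max {k'. k' \<le> k \<and> blk R k' = i}"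

definition last_op where
  "last_op P \<alpha> R i k = (let k' = last_iter R i k in op R k' (accepted P \<alpha> R k'))"

definition last_mult where
  "last_mult P \<alpha> R i k = (let k' = last_iter R i k in mult R k' (accepted P \<alpha> R k'))"

definition residual where
  "residual P \<alpha> R i k =
     norm (lagr P i (last_op P \<alpha> R i k) (last_mult P \<alpha> R i k) (bpart P i (iter R (Suc k)))
             (grad_obj P i (iter R (Suc k))))"

definition sigma_max :: "real \<Rightarrow> real \<Rightarrow> real \<Rightarrow> real" where
  "sigma_max \<alpha> \<gamma> cB = 2 * (\<gamma> + cB + 2 * \<alpha>)"

(* c_4 as a function of the upper bound on the accepted regularization parameters. A rejected one
   is below \<gamma> + cB + 2 \<alpha>, hence an accepted one is either 0, or \<sigma>min, or less than sigma_max;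
   so sigma_max itself is an upper bound only if \<sigma>min does not exceed it. *)
definition c4 :: "real \<Rightarrow> real \<Rightarrow> real \<Rightarrow> real \<Rightarrow> real" where
  "c4 cB \<sigma> \<theta> \<gamma> = cB + \<sigma> + \<theta> + \<gamma>"

end

theory Submission
  imports Defs
begin

text \<open>
  Write \<open>s\<^sub>k\<close> for the accepted step of iteration \<open>k\<close>.

  A trial with regularization \<open>\<sigma> > 0\<close> satisfies Alternative 1, so the quadratic upper bound on the
  objective gives a decrease of at least \<open>(\<sigma> - cB - \<gamma>)/2 * \<parallel>s\<parallel>\<^sup>2\<close>. Hence no trial with
  \<open>\<sigma> \<ge> \<gamma> + cB + 2 * \<alpha>\<close> is rejected. As \<open>\<sigma>\<close> at least doubles after every rejection beyond the
  first, the inner loop ends (\<open>descent_accepted\<close>), and the accepted \<open>\<sigma>\<close> is at most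
  \<open>max \<sigma>min (sigma_max \<alpha> \<gamma> cB)\<close> (\<open>reg_accepted_le\<close>). Every iteration then lowers the objective by
  \<open>\<alpha> * \<parallel>s\<^sub>k\<parallel>\<^sup>2\<close>, so the sum of all \<open>\<parallel>s\<^sub>k\<parallel>\<^sup>2\<close> is at most \<open>(f(x\<^sup>0) - fbound)/\<alpha>\<close>
  (\<open>sum_norm_step_squared_le\<close>).

  Right after block \<open>i\<close> is updated at iteration \<open>k'\<close>, its residual is at most \<open>c * \<parallel>s\<^bsub>k'\<^esub>\<parallel>\<close>, by
  Alternative 1 or 2, where \<open>c\<close> is \<open>c4\<close> at the bound on the accepted \<open>\<sigma>\<close>. Until block \<open>i\<close> is
  updated again, the constraint part of the residual is frozen, and each iteration \<open>t\<close> moves the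
  gradient of the objective by at most \<open>\<gamma> * \<parallel>s\<^sub>t\<parallel>\<close>. Block \<open>i\<close> is updated at least once in every
  \<open>m\<close> iterations, so the residual at \<open>k\<close> is at most \<open>c\<close> times the sum of the last \<open>m\<close> step
  lengths (\<open>residual_le_window\<close>).

  To count the \<open>k\<close> with residual above \<open>\<epsilon>\<close>, it is not enough to say that one of the last \<open>m\<close> steps
  is longer than \<open>\<epsilon>/(c * m)\<close>: one long step may serve \<open>m\<close> different \<open>k\<close>, which would cost an extra
  factor \<open>m\<close>. The Cauchy-Schwarz inequality on the window avoids this
  (\<open>card_times_le_of_window_bound\<close>): each such \<open>k\<close> has \<open>\<epsilon>\<^sup>2 < c\<^sup>2 * m * (sum of the last m
  squares)\<close>, and every square lies in at most \<open>m\<close> windows. Finiteness of this count for all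
  \<open>\<epsilon>\<close> is the convergence of the residual to zero.
\<close>

section \<open>Counting large values of a sequence dominated by window sums\<close>

text \<open>Cauchy-Schwarz turns the bound on \<open>r k\<close> into one by squares, \<open>m\<close> of them with the factor
  \<open>c\<^sup>2 * m\<close>. When these are summed over \<open>F\<close>, the terms with a fixed lag \<open>j\<close> are distinct squares,
  whose total is at most \<open>C\<close>, and there are \<open>m\<close> lags.\<close>

lemma card_times_le_of_window_bound:
  fixes s r :: "nat \<Rightarrow> real" and c C \<epsilon> :: real and m :: nat
  assumes F: "finite F" "F \<subseteq> {k. k \<ge> m \<and> r k > \<epsilon>}"
    and \<epsilon>: "\<epsilon> > 0" and c: "c > 0" and m: "m \<ge> 1"
    and sq: "\<And>N. (\<Sum>t<N. (s t)\<^sup>2) \<le> C"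
    and win: "\<And>k. k \<ge> m \<Longrightarrow> r k \<le> c * (\<Sum>j<m. s (k - j))"
  shows "real (card F) * (\<epsilon> / (c * real m))\<^sup>2 \<le> C"
proof -
  \<comment> \<open>Truncated subtraction is injective on \<open>F\<close>, as \<open>j < m \<le> k\<close>.\<close>
  have sq_on: "(\<Sum>k\<in>F. (s (k - j))\<^sup>2) \<le> C" if "j < m" for j
  proof -
    have inj: "inj_on (\<lambda>k. k - j) F"
      using F(2) that by (auto simp: inj_on_def)
    have "(\<Sum>k\<in>F. (s (k - j))\<^sup>2) = (\<Sum>t\<in>(\<lambda>k. k - j) ` F. (s t)\<^sup>2)"
      by (simp add: sum.reindex[OF inj])
    also obtain N where N: "\<forall>t\<in>(\<lambda>k. k - j) ` F. t < N"
      using F(1) finite_nat_set_iff_bounded by blast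
    then have "(\<Sum>t\<in>(\<lambda>k. k - j) ` F. (s t)\<^sup>2) \<le> (\<Sum>t<N. (s t)\<^sup>2)"
      by (intro sum_mono2) auto
    also have "\<dots> \<le> C" by (rule sq)
    finally show ?thesis .
  qed
  have each: "\<epsilon>\<^sup>2 \<le> c\<^sup>2 * (real m * (\<Sum>j<m. (s (k - j))\<^sup>2))" if "k \<in> F" for k
  proof -
    have "\<epsilon> \<le> c * (\<Sum>j<m. s (k - j))"
      using F(2) that win[of k] by force
    then have "\<epsilon>\<^sup>2 \<le> (c * (\<Sum>j<m. s (k - j)))\<^sup>2"
      using \<epsilon> by (intro power_mono) auto
    also have "\<dots> = c\<^sup>2 * (\<Sum>j<m. s (k - j))\<^sup>2"
      by (simp add: power_mult_distrib)
    also have "(\<Sum>j<m. s (k - j))\<^sup>2 \<le> real m * (\<Sum>j<m. (s (k - j))\<^sup>2)"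
      using sum_squared_le_sum_of_squares[of "\<lambda>j. s (k - j)" "{..<m}"] by (simp add: mult.commute)
    finally show ?thesis using c by (simp add: mult_left_mono)
  qed
  have "real (card F) * \<epsilon>\<^sup>2 \<le> (\<Sum>k\<in>F. c\<^sup>2 * (real m * (\<Sum>j<m. (s (k - j))\<^sup>2)))"
    using sum_mono[of F "\<lambda>k. \<epsilon>\<^sup>2", OF each] by simp
  also have "\<dots> = c\<^sup>2 * (real m * (\<Sum>k\<in>F. \<Sum>j<m. (s (k - j))\<^sup>2))"
    by (simp only: sum_distrib_left)
  also have "(\<Sum>k\<in>F. \<Sum>j<m. (s (k - j))\<^sup>2) = (\<Sum>j<m. \<Sum>k\<in>F. (s (k - j))\<^sup>2)"
    by (rule sum.swap)
  also have "c\<^sup>2 * (real m * \<dots>) \<le> c\<^sup>2 * (real m * (\<Sum>j<m. C))"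
    using sq_on by (intro mult_left_mono sum_mono) auto
  also have "\<dots> = C * (c * real m)\<^sup>2"
    by (simp add: power2_eq_square mult_ac)
  finally show ?thesis
    using c m by (simp add: power_divide divide_le_eq)
qed

text \<open>The preceding bound does not depend on \<open>F\<close>, so it caps the cardinality of every finite set
  of large values.\<close>

lemma finite_large_values_of_window_bound:
  fixes s r :: "nat \<Rightarrow> real" and c C \<epsilon> :: real and m :: nat
  assumes \<epsilon>: "\<epsilon> > 0" and c: "c > 0" and m: "m \<ge> 1"
    and sq: "\<And>N. (\<Sum>t<N. (s t)\<^sup>2) \<le> C"
    and win: "\<And>k. k \<ge> m \<Longrightarrow> r k \<le> c * (\<Sum>j<m. s (k - j))"
  shows "finite {k. k \<ge> m \<and> r k > \<epsilon>}"
proof (rule ccontr)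
  let ?q = "(\<epsilon> / (c * real m))\<^sup>2"
  assume inf: "infinite {k. k \<ge> m \<and> r k > \<epsilon>}"
  have q: "?q > 0" using \<epsilon> c m by simp
  obtain n where n: "C < real n * ?q"
    using reals_Archimedean3[OF q] by blast
  obtain F where F: "finite F" "card F = n" "F \<subseteq> {k. k \<ge> m \<and> r k > \<epsilon>}"
    using infinite_arbitrarily_large[OF inf] by blast
  have "real (card F) * ?q \<le> C"
    by (rule card_times_le_of_window_bound[OF F(1) F(3) \<epsilon> c m sq win])
  then show False using n F(2) by simp
qed

section \<open>Recurrent index sets\<close>

text \<open>The last element of \<open>S\<close> up to \<open>k\<close> is less than \<open>m\<close> behind \<open>k\<close>, since its successor in \<open>S\<close>
  comes after \<open>k\<close> and at most \<open>m\<close> later. The bound on the first element makes sure that there is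
  one.\<close>

lemma Max_le_window_of_enumerate:
  fixes S :: "nat set"
  assumes S: "infinite S" and first: "enumerate S 0 \<le> m"
    and gap: "\<And>j. enumerate S (Suc j) - enumerate S j \<le> m" and k: "m \<le> k"
  defines "k' \<equiv> Max {t. t \<le> k \<and> t \<in> S}"
  shows "k' \<in> S" "k' \<le> k" "k < k' + m" "\<And>t. k' < t \<Longrightarrow> t \<le> k \<Longrightarrow> t \<notin> S"
proof -
  let ?T = "{t. t \<le> k \<and> t \<in> S}"
  have fin: "finite ?T" by (rule finite_subset[of _ "{..k}"]) auto
  have "enumerate S 0 \<in> ?T"
    using enumerate_in_set[OF S, of 0] first k by simp
  then have k'T: "k' \<in> ?T"
    unfolding k'_def using fin by (intro Max_in) auto
  then show "k' \<in> S" "k' \<le> k" by auto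
  show nxt: "t \<notin> S" if "k' < t" "t \<le> k" for t
    using Max_ge[OF fin, of t] that unfolding k'_def by fastforce
  obtain j where j: "enumerate S j = k'"
    using enumerate_Ex[OF S \<open>k' \<in> S\<close>] by blast
  have "k' < enumerate S (Suc j)"
    using enumerate_step[OF S, of j] j by simp
  moreover have "enumerate S (Suc j) \<in> S" by (rule enumerate_in_set[OF S])
  ultimately have "k < enumerate S (Suc j)"
    using nxt[of "enumerate S (Suc j)"] by force
  then show "k < k' + m" using gap[of j] j \<open>k' < enumerate S (Suc j)\<close> by linarith
qed

section \<open>Blocks\<close>

lemma block_part_upd_same:
  "v \<in> block_space b i \<Longrightarrow> block_part b i (block_upd b i x v) = v"
  by (auto simp: block_part_def block_upd_def block_space_def vec_eq_iff)

lemma block_part_upd_other: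
  "i \<noteq> d \<Longrightarrow> block_part b i (block_upd b d x v) = block_part b i x"
  by (auto simp: block_part_def block_upd_def vec_eq_iff)

lemma block_upd_part: "block_upd b i x (block_part b i x) = x"
  by (auto simp: block_part_def block_upd_def vec_eq_iff)

lemma norm_lagr_le:
  "norm (lagr P i j \<mu> y G) \<le> norm (lagr P i j \<mu> y H) + norm (G - H)"
proof -
  have "lagr P i j \<mu> y G = lagr P i j \<mu> y H + (G - H)"
    by (simp add: lagr_def)
  then show ?thesis by (metis norm_triangle_ineq)
qed

section \<open>Growth of the regularization parameter\<close>

lemma reg_Suc_ge:
  assumes "\<sigma> > 0"
  shows "\<sigma> * 2 ^ r \<le> reg \<sigma> (Suc r)"
  by (induction r) (auto simp: max_def)

lemma reg_pos: "\<sigma> > 0 \<Longrightarrow> r > 0 \<Longrightarrow> reg \<sigma> r > 0"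
  using reg_Suc_ge[of \<sigma> "r - 1"] by (simp add: less_le_trans[rotated])

section \<open>Runs of block coordinate descent\<close>

locale bcd_convergence =
  fixes P :: "('n::finite) bcd_problem" and R :: "'n bcd_run"
    and \<alpha> \<delta> \<theta> \<sigma>min \<gamma> cB :: real
  assumes \<alpha>: "\<alpha> > 0" and \<delta>: "\<delta> \<ge> 0" and \<theta>: "\<theta> > 0" and \<sigma>min: "\<sigma>min > 0"
    and problem: "bcd_problem P"
    and run: "bcd_run P \<alpha> \<delta> \<theta> \<sigma>min R"
    and \<gamma>: "\<gamma> > 0" and lipschitz: "lipschitz_assm P \<alpha> R \<gamma>"
    and cB: "cB > 0" and hessian: "bounded_hessian_assm R cB"
begin

definition trial_step :: "nat \<Rightarrow> nat \<Rightarrow> real ^ 'n" where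
  "trial_step k r = trial R k r - bpart P (blk R k) (iter R k)"

abbreviation acc :: "nat \<Rightarrow> nat" where
  "acc \<equiv> accepted P \<alpha> R"

abbreviation step :: "nat \<Rightarrow> real ^ 'n" where
  "step k \<equiv> trial_step k (acc k)"

abbreviation \<sigma>bound :: real where
  "\<sigma>bound \<equiv> max \<sigma>min (sigma_max \<alpha> \<gamma> cB)"

abbreviation c :: real where
  "c \<equiv> c4 cB \<sigma>bound \<theta> \<gamma>"

lemma blk_in: "blk R k \<in> {1..nblocks P}"
  using run by (simp add: bcd_run_def)

lemma attempted_trial:
  assumes "attempted P \<alpha> R k r"
  shows "op R k r \<in> {1..nops P (blk R k)}"
    and "trial R k r \<in> cover P (blk R k) (op R k r)"
    and "alternative1 P \<delta> \<theta> (reg \<sigma>min r) (blk R k) (hess R k) (iter R k)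
           (op R k r) (trial R k r) (mult R k r) \<or>
         reg \<sigma>min r = 0 \<and>
         alternative2 P (blk R k) (iter R k) (op R k r) (trial R k r) (mult R k r)"
  using run assms unfolding bcd_run_def by blast+

lemma trial_in_bspace:
  assumes "attempted P \<alpha> R k r"
  shows "trial R k r \<in> bspace P (blk R k)"
proof -
  have "openin (top_of_set (bspace P (blk R k))) (cover P (blk R k) (op R k r))"
    using problem blk_in attempted_trial(1)[OF assms] unfolding bcd_problem_def by blast
  then show ?thesis
    using attempted_trial(2)[OF assms] by (auto dest: openin_imp_subset)
qed

lemma norm_hess_le: "norm (hess R k *v v) \<le> cB * norm v"
proof -
  have "norm (hess R k *v v) \<le> onorm ((*v) (hess R k)) * norm v"
    by (rule onorm[OF matrix_vector_mul_bounded_linear])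
  also have "\<dots> \<le> cB * norm v"
    using hessian by (intro mult_right_mono) (auto simp: bounded_hessian_assm_def)
  finally show ?thesis .
qed

subsection \<open>The inner loop ends with a bounded regularization parameter\<close>

text \<open>The model decrease in Alternative 1 turns the quadratic upper bound on the objective into a
  decrease of \<open>(reg \<sigma>min r - cB - \<gamma>)/2 * (norm s)\<^sup>2\<close>.\<close>

lemma descent_if_reg_large:
  assumes att: "attempted P \<alpha> R k r" and pos: "reg \<sigma>min r > 0"
    and large: "reg \<sigma>min r \<ge> \<gamma> + cB + 2 * \<alpha>"
  shows "descent P \<alpha> R k r"
proof -
  let ?s = "trial_step k r" and ?g = "grad_obj P (blk R k) (iter R k)"
  have model: "?g \<bullet> ?s + 1/2 * (?s \<bullet> (hess R k *v ?s)) + reg \<sigma>min r/2 * (norm ?s)\<^sup>2 \<le> 0"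
    using attempted_trial(3)[OF att] pos
    by (auto simp: alternative1_def Let_def trial_step_def)
  have lip: "obj P (trial_point P R k r) \<le> obj P (iter R k) + ?g \<bullet> ?s + \<gamma>/2 * (norm ?s)\<^sup>2"
    using lipschitz att unfolding lipschitz_assm_def
    by (auto simp: Let_def trial_step_def norm_minus_commute)
  have "\<bar>?s \<bullet> (hess R k *v ?s)\<bar> \<le> norm ?s * norm (hess R k *v ?s)"
    by (rule Cauchy_Schwarz_ineq2)
  also have "\<dots> \<le> norm ?s * (cB * norm ?s)"
    by (intro mult_left_mono norm_hess_le) auto
  also have "\<dots> = cB * (norm ?s)\<^sup>2" by (simp add: power2_eq_square)
  finally have quad: "- (cB * (norm ?s)\<^sup>2) \<le> ?s \<bullet> (hess R k *v ?s)" by linarith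
  have "(\<gamma> + cB + 2 * \<alpha>) * (norm ?s)\<^sup>2 \<le> reg \<sigma>min r * (norm ?s)\<^sup>2"
    by (intro mult_right_mono large) auto
  then have "obj P (trial_point P R k r) \<le> obj P (iter R k) - \<alpha> * (norm ?s)\<^sup>2"
    using lip model quad by (simp add: algebra_simps)
  then show ?thesis by (simp add: descent_def trial_step_def)
qed

lemma descent_accepted: "descent P \<alpha> R k (acc k)"
proof -
  have "\<exists>r. descent P \<alpha> R k r"
  proof (rule ccontr)
    assume none: "\<nexists>r. descent P \<alpha> R k r"
    obtain n where n: "(\<gamma> + cB + 2 * \<alpha>) / \<sigma>min < 2 ^ n"
      using real_arch_pow[of 2] by auto
    have "\<gamma> + cB + 2 * \<alpha> \<le> \<sigma>min * 2 ^ n"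
      using n \<sigma>min by (simp add: field_simps)
    also have "\<dots> \<le> reg \<sigma>min (Suc n)" by (rule reg_Suc_ge[OF \<sigma>min])
    finally have "descent P \<alpha> R k (Suc n)"
      using none reg_pos[OF \<sigma>min, of "Suc n"]
      by (intro descent_if_reg_large) (simp_all add: attempted_def)
    then show False using none by blast
  qed
  then show ?thesis unfolding accepted_def by (rule LeastI_ex)
qed

lemma attempted_if_le_accepted: "r \<le> acc k \<Longrightarrow> attempted P \<alpha> R k r"
  unfolding attempted_def accepted_def by (meson less_le_trans not_less_Least)

text \<open>The accepted parameter is the initial one, zero, or it stems from a rejected one, which is
  either zero or less than \<open>sigma_max \<alpha> \<gamma> cB / 2\<close>.\<close>

lemma reg_accepted_le: "0 \<le> reg \<sigma>min (acc k)" "reg \<sigma>min (acc k) \<le> \<sigma>bound"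
proof -
  show "0 \<le> reg \<sigma>min (acc k)"
    using reg_pos[OF \<sigma>min, of "acc k"] by (cases "acc k") auto
  show "reg \<sigma>min (acc k) \<le> \<sigma>bound"
  proof (cases "acc k")
    case 0
    then show ?thesis using \<sigma>min by simp
  next
    case (Suc r)
    then have att: "attempted P \<alpha> R k r" and rej: "\<not> descent P \<alpha> R k r"
      using attempted_if_le_accepted[of r k] not_less_Least[of r "descent P \<alpha> R k"]
      by (auto simp: accepted_def)
    have "2 * reg \<sigma>min r \<le> sigma_max \<alpha> \<gamma> cB"
    proof (cases "r = 0")
      case True
      then show ?thesis using \<alpha> \<gamma> cB by (simp add: sigma_max_def)
    next
      case False
      then show ?thesis
        using descent_if_reg_large[OF att] rej reg_pos[OF \<sigma>min, of r]
        by (force simp: sigma_max_def)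
    qed
    then show ?thesis using Suc by auto
  qed
qed

lemma c_pos: "c > 0" and \<gamma>_le_c: "\<gamma> \<le> c"
  using cB \<theta> \<gamma> \<sigma>min by (auto simp: c4_def)

subsection \<open>The accepted steps\<close>

lemma attempted_accepted: "attempted P \<alpha> R k (acc k)"
  by (rule attempted_if_le_accepted) simp

lemma iter_Suc: "iter R (Suc k) = trial_point P R k (acc k)"
  using run attempted_accepted descent_accepted unfolding bcd_run_def by blast

lemma bpart_iter_Suc_same: "bpart P (blk R k) (iter R (Suc k)) = trial R k (acc k)"
  unfolding iter_Suc trial_point_def
  by (rule block_part_upd_same[OF trial_in_bspace[OF attempted_accepted]])

lemma bpart_iter_Suc_other: "i \<noteq> blk R k \<Longrightarrow> bpart P i (iter R (Suc k)) = bpart P i (iter R k)"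
  unfolding iter_Suc trial_point_def by (rule block_part_upd_other)

lemma sum_norm_step_squared_le:
  assumes "\<And>k. fbound \<le> obj P (iter R k)"
  shows "(\<Sum>t<N. (norm (step t))\<^sup>2) \<le> (obj P (iter R 0) - fbound) / \<alpha>"
proof -
  have "\<alpha> * (\<Sum>t<N. (norm (step t))\<^sup>2) \<le> obj P (iter R 0) - obj P (iter R N)"
  proof (induction N)
    case (Suc N)
    have "obj P (iter R (Suc N)) \<le> obj P (iter R N) - \<alpha> * (norm (step N))\<^sup>2"
      using descent_accepted[of N] by (simp add: descent_def iter_Suc trial_step_def)
    with Suc show ?case by (simp add: algebra_simps)
  qed simp
  also have "\<dots> \<le> obj P (iter R 0) - fbound" using assms[of N] by simp
  finally show ?thesis using \<alpha> by (simp add: field_simps)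
qed

text \<open>The Lipschitz bound for all block gradients requires the two iterates to differ. They coincide
  exactly when the step vanishes, and then there is nothing to bound.\<close>

lemma grad_change_le:
  assumes i: "i \<in> {1..nblocks P}"
  shows "norm (grad_obj P i (iter R (Suc k)) - grad_obj P i (iter R k)) \<le> \<gamma> * norm (step k)"
proof (cases "bpart P (blk R k) (iter R (Suc k)) = bpart P (blk R k) (iter R k)")
  case True
  then have "iter R (Suc k) = iter R k"
    unfolding bpart_iter_Suc_same by (simp add: iter_Suc trial_point_def block_upd_part)
  then show ?thesis using \<gamma> by simp
next
  case False
  have "norm (grad_obj P i (iter R (Suc k)) - grad_obj P i (iter R k))
      \<le> \<gamma> * norm (bpart P (blk R k) (iter R k) - bpart P (blk R k) (iter R (Suc k)))"
    using lipschitz False i blk_in[of k] bpart_iter_Suc_other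
    unfolding lipschitz_assm_def by blast
  then show ?thesis
    by (simp add: bpart_iter_Suc_same trial_step_def norm_minus_commute)
qed

lemma grad_change_le_sum:
  assumes i: "i \<in> {1..nblocks P}" and "k' \<le> k"
  shows "norm (grad_obj P i (iter R (Suc k)) - grad_obj P i (iter R (Suc k')))
    \<le> \<gamma> * (\<Sum>t\<in>{k'<..k}. norm (step t))"
  using \<open>k' \<le> k\<close>
proof (induction k rule: dec_induct)
  case (step n)
  have "{k'<..Suc n} = insert (Suc n) {k'<..n}" using step by auto
  then have "(\<Sum>t\<in>{k'<..Suc n}. norm (trial_step t (acc t)))
      = norm (trial_step (Suc n) (acc (Suc n))) + (\<Sum>t\<in>{k'<..n}. norm (trial_step t (acc t)))"
    by simp
  moreover have "norm (grad_obj P i (iter R (Suc (Suc n))) - grad_obj P i (iter R (Suc k')))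
      \<le> norm (grad_obj P i (iter R (Suc (Suc n))) - grad_obj P i (iter R (Suc n)))
        + norm (grad_obj P i (iter R (Suc n)) - grad_obj P i (iter R (Suc k')))"
    by (rule order_trans[OF _ norm_triangle_ineq]) simp
  ultimately show ?case
    using step.IH grad_change_le[OF i, of "Suc n"] by (simp add: algebra_simps)
qed simp

subsection \<open>Stationarity of the block that has just been updated\<close>

lemma multipliers_accepted:
  assumes "l \<in> {1..ncons P (blk R k) (op R k (acc k))}"
  shows "mult R k (acc k) l \<ge> 0"
    and "min (mult R k (acc k) l) (- con P (blk R k) (op R k (acc k)) l (trial R k (acc k))) \<le> \<delta>"
proof -
  let ?j = "op R k (acc k)" and ?y = "trial R k (acc k)" and ?\<mu> = "mult R k (acc k)"
  have "(\<forall>l\<in>{1..ncons P (blk R k) ?j}. ?\<mu> l \<ge> 0) \<and>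
    ((\<forall>l\<in>{1..ncons P (blk R k) ?j}. min (?\<mu> l) (- con P (blk R k) ?j l ?y) \<le> \<delta>) \<or>
     (\<forall>l\<in>{1..ncons P (blk R k) ?j}. min (?\<mu> l) (- con P (blk R k) ?j l ?y) \<le> 0))"
    using attempted_trial(3)[OF attempted_accepted, of k]
    unfolding alternative1_def alternative2_def Let_def by blast
  then have "?\<mu> l \<ge> 0 \<and> (min (?\<mu> l) (- con P (blk R k) ?j l ?y) \<le> \<delta> \<or>
      min (?\<mu> l) (- con P (blk R k) ?j l ?y) \<le> 0)"
    using assms by blast
  then show "?\<mu> l \<ge> 0" and "min (?\<mu> l) (- con P (blk R k) ?j l ?y) \<le> \<delta>"
    using \<delta> by linarith+
qed

text \<open>Alternative 2 makes this quantity zero; Alternative 1 speaks of the regularized model gradient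
  at the old iterate, from which the gradient at the new one differs by at most
  \<open>(\<gamma> + cB + \<sigma>) * norm (step k)\<close>.\<close>

lemma norm_lagr_accepted_le:
  "norm (lagr P (blk R k) (op R k (acc k)) (mult R k (acc k)) (trial R k (acc k))
      (grad_obj P (blk R k) (iter R (Suc k)))) \<le> c * norm (step k)"
proof -
  let ?L = "lagr P (blk R k) (op R k (acc k)) (mult R k (acc k)) (trial R k (acc k))"
  let ?G = "grad_obj P (blk R k) (iter R (Suc k))"
  let ?i = "blk R k" and ?\<sigma> = "reg \<sigma>min (acc k)" and ?s = "step k"
  let ?g = "grad_obj P ?i (iter R k)"
  from attempted_trial(3)[OF attempted_accepted, of k]
  consider (model) "norm (?L (?g + hess R k *v ?s + ?\<sigma> *\<^sub>R ?s)) \<le> \<theta> * norm ?s"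
    | (exact) "norm (?L ?G) = 0"
    unfolding alternative1_def alternative2_def Let_def trial_step_def iter_Suc trial_point_def
    by blast
  then show ?thesis
  proof cases
    case model
    let ?H = "?g + hess R k *v ?s + ?\<sigma> *\<^sub>R ?s"
    have "?G - ?H = (?G - ?g) + - (hess R k *v ?s + ?\<sigma> *\<^sub>R ?s)" by simp
    then have "norm (?G - ?H) \<le> norm (?G - ?g) + norm (- (hess R k *v ?s + ?\<sigma> *\<^sub>R ?s))"
      by (simp only: norm_triangle_ineq)
    also have "\<dots> \<le> norm (?G - ?g) + (norm (hess R k *v ?s) + norm (?\<sigma> *\<^sub>R ?s))"
      using norm_triangle_ineq[of "hess R k *v ?s" "?\<sigma> *\<^sub>R ?s"]
      by (simp only: norm_minus_cancel add_left_mono)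
    also have "\<dots> \<le> \<gamma> * norm ?s + (cB * norm ?s + \<sigma>bound * norm ?s)"
    proof (intro add_mono)
      show "norm (?\<sigma> *\<^sub>R ?s) \<le> \<sigma>bound * norm ?s"
        using mult_right_mono[OF reg_accepted_le(2) norm_ge_zero, of k ?s] reg_accepted_le(1)[of k]
        by simp
    qed (rule grad_change_le[OF blk_in] norm_hess_le)+
    finally have "norm (?G - ?H) \<le> \<gamma> * norm ?s + (cB * norm ?s + \<sigma>bound * norm ?s)" .
    then have "norm (?L ?G) \<le> \<theta> * norm ?s + (\<gamma> * norm ?s + (cB * norm ?s + \<sigma>bound * norm ?s))"
      using norm_lagr_le[of P ?i "op R k (acc k)" "mult R k (acc k)" "trial R k (acc k)" ?G ?H] model
      by linarith
    then show ?thesis by (simp add: c4_def algebra_simps)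
  next
    case exact
    then show ?thesis using c_pos by simp
  qed
qed

subsection \<open>The residual between two updates of a block\<close>

context
  fixes m i k :: nat
  assumes choice: "block_choice_assm P R m" and i: "i \<in> {1..nblocks P}" and k: "m \<le> k"
begin

lemma last_iter_window:
  shows "blk R (last_iter R i k) = i" "last_iter R i k \<le> k" "k < last_iter R i k + m"
    and "\<And>t. last_iter R i k < t \<Longrightarrow> t \<le> k \<Longrightarrow> blk R t \<noteq> i"
proof -
  let ?S = "{t. blk R t = i}"
  have "infinite ?S" "enumerate ?S 0 \<le> m"
    and "enumerate ?S (Suc j) - enumerate ?S j \<le> m" for j
    using choice i unfolding block_choice_assm_def by blast+
  note window = Max_le_window_of_enumerate[OF this k]
  have last: "last_iter R i k = Max {t. t \<le> k \<and> t \<in> ?S}"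
    by (simp add: last_iter_def)
  show "blk R (last_iter R i k) = i" "last_iter R i k \<le> k" "k < last_iter R i k + m"
    using window(1-3) unfolding last by blast+
  show "blk R t \<noteq> i" if "last_iter R i k < t" "t \<le> k" for t
    using window(4)[of t] that unfolding last by blast
qed

lemma bpart_iter_last_iter:
  "bpart P i (iter R (Suc k)) = trial R (last_iter R i k) (acc (last_iter R i k))"
proof -
  let ?k' = "last_iter R i k"
  have "bpart P i (iter R (Suc t)) = bpart P i (iter R (Suc ?k'))" if "?k' \<le> t" "t \<le> k" for t
    using that
  proof (induction t rule: dec_induct)
    case (step n)
    then show ?case
      using last_iter_window(4)[of "Suc n"] bpart_iter_Suc_other[of i "Suc n"] by simp
  qed simp
  then have "bpart P i (iter R (Suc k)) = bpart P i (iter R (Suc ?k'))"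
    using last_iter_window(2) by blast
  then show ?thesis
    using bpart_iter_Suc_same[of ?k'] last_iter_window(1) by simp
qed

lemma last_multipliers:
  assumes "l \<in> {1..ncons P i (last_op P \<alpha> R i k)}"
  shows "last_mult P \<alpha> R i k l \<ge> 0"
    and "min (last_mult P \<alpha> R i k l)
           (- con P i (last_op P \<alpha> R i k) l (bpart P i (iter R (Suc k)))) \<le> \<delta>"
  using multipliers_accepted[of l "last_iter R i k"] assms
  unfolding bpart_iter_last_iter last_op_def last_mult_def Let_def last_iter_window(1)
  by blast+

lemma bpart_in_last_cover: "bpart P i (iter R (Suc k)) \<in> cover P i (last_op P \<alpha> R i k)"
  using attempted_trial(2)[OF attempted_accepted, of "last_iter R i k"]
  unfolding bpart_iter_last_iter last_op_def Let_def last_iter_window(1) .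

text \<open>The step that last updated block \<open>i\<close> accounts for the stationarity error at that time, the
  later ones for the drift of the gradient since then. Because \<open>\<gamma> \<le> c\<close>, the same factor serves
  both.\<close>

lemma residual_le_window: "residual P \<alpha> R i k \<le> c * (\<Sum>j<m. norm (step (k - j)))"
proof -
  let ?k' = "last_iter R i k"
  let ?L = "lagr P i (op R ?k' (acc ?k')) (mult R ?k' (acc ?k')) (trial R ?k' (acc ?k'))"
  let ?G = "\<lambda>t. grad_obj P i (iter R (Suc t))"
  have "residual P \<alpha> R i k = norm (?L (?G k))"
    unfolding residual_def bpart_iter_last_iter last_op_def last_mult_def Let_def ..
  also have "\<dots> \<le> norm (?L (?G ?k')) + norm (?G k - ?G ?k')" by (rule norm_lagr_le)
  also have "\<dots> \<le> c * norm (step ?k') + \<gamma> * (\<Sum>t\<in>{?k'<..k}. norm (step t))"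
    using norm_lagr_accepted_le[of ?k'] grad_change_le_sum[OF i last_iter_window(2)]
    unfolding last_iter_window(1) by (rule add_mono)
  also have "\<dots> \<le> c * norm (step ?k') + c * (\<Sum>t\<in>{?k'<..k}. norm (step t))"
    using \<gamma>_le_c by (intro add_left_mono mult_right_mono sum_nonneg) auto
  also have "\<dots> = c * (\<Sum>t\<in>{?k'..k}. norm (step t))"
    using last_iter_window(2) by (simp add: sum.head distrib_left)
  \<comment> \<open>At most \<open>m\<close> steps are involved; extending the sum to exactly \<open>m\<close> makes the window independent
    of \<open>i\<close>.\<close>
  also have "(\<Sum>t\<in>{?k'..k}. norm (step t)) \<le> (\<Sum>t\<in>(\<lambda>j. k - j) ` {..<m}. norm (step t))"
  proof (rule sum_mono2)
    show "{?k'..k} \<subseteq> (\<lambda>j. k - j) ` {..<m}"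
    proof
      fix t assume "t \<in> {?k'..k}"
      then show "t \<in> (\<lambda>j. k - j) ` {..<m}"
        using last_iter_window(3) by (intro image_eqI[of _ _ "k - t"]) auto
    qed
  qed auto
  also have "\<dots> = (\<Sum>j<m. norm (step (k - j)))"
    using k by (subst sum.reindex) (auto simp: inj_on_def)
  finally show ?thesis using c_pos by (simp add: mult_left_mono)
qed

end

subsection \<open>Counting and convergence\<close>

context
  fixes m i :: nat
  assumes choice: "block_choice_assm P R m" and m: "m \<ge> 1" and i: "i \<in> {1..nblocks P}"
begin

lemma large_residuals:
  assumes \<epsilon>: "\<epsilon> > 0" and fbound: "\<And>k. fbound \<le> obj P (iter R k)"
  shows "finite {k. k \<ge> m \<and> residual P \<alpha> R i k > \<epsilon>}"
    and "real (card {k. k \<ge> m \<and> residual P \<alpha> R i k > \<epsilon>})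
      \<le> (obj P (iter R 0) - fbound) / (\<alpha> * (\<epsilon> / (c * real m))\<^sup>2)"
proof -
  let ?K = "{k. k \<ge> m \<and> residual P \<alpha> R i k > \<epsilon>}"
  note window = residual_le_window[OF choice i]
  note squares = sum_norm_step_squared_le[OF fbound]
  show fin: "finite ?K"
    by (rule finite_large_values_of_window_bound[where s = "\<lambda>t. norm (step t)",
          OF \<epsilon> c_pos m squares window])
  have "real (card ?K) * (\<epsilon> / (c * real m))\<^sup>2 \<le> (obj P (iter R 0) - fbound) / \<alpha>"
    by (rule card_times_le_of_window_bound[where s = "\<lambda>t. norm (step t)",
          OF fin order.refl \<epsilon> c_pos m squares window])
  moreover have "\<alpha> * (\<epsilon> / (c * real m))\<^sup>2 > 0" using \<alpha> \<epsilon> c_pos m by simp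
  ultimately show "real (card ?K) \<le> (obj P (iter R 0) - fbound) / (\<alpha> * (\<epsilon> / (c * real m))\<^sup>2)"
    using \<alpha> by (simp add: pos_le_divide_eq mult_ac)
qed

lemma residual_tendsto_zero:
  assumes "lower_bounded_assm P R"
  shows "residual P \<alpha> R i \<longlonglongrightarrow> 0"
proof (rule tendstoI)
  fix e :: real assume e: "e > 0"
  obtain fbound where fbound: "\<And>k. fbound \<le> obj P (iter R k)"
    using assms by (auto simp: lower_bounded_assm_def bdd_below_def)
  have "finite {k. k \<ge> m \<and> residual P \<alpha> R i k > e / 2}"
    using e by (intro large_residuals(1)[OF _ fbound]) simp
  then have "\<forall>\<^sub>F k in sequentially. \<not> (k \<ge> m \<and> residual P \<alpha> R i k > e / 2)"
    by (simp only: cofinite_eq_sequentially[symmetric] eventually_cofinite not_not)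
  then show "\<forall>\<^sub>F k in sequentially. dist (residual P \<alpha> R i k) 0 < e"
    using eventually_ge_at_top[of m]
    by eventually_elim (use e in \<open>auto simp: residual_def\<close>)
qed

end

end

section \<open>Convergence and complexity of block coordinate descent\<close>

theorem theorem4p1:
  fixes P :: "('n::finite) bcd_problem" and R :: "'n bcd_run"
    and \<alpha> \<delta> \<theta> \<sigma>min \<gamma> cB :: real and m :: nat
  assumes "\<alpha> > 0" and "\<delta> \<ge> 0" and "\<theta> > 0" and "\<sigma>min > 0"
    and "bcd_problem P"
    and "bcd_run P \<alpha> \<delta> \<theta> \<sigma>min R"
    and "\<gamma> > 0" and "lipschitz_assm P \<alpha> R \<gamma>"
    and "cB > 0" and "bounded_hessian_assm R cB"
    and "lower_bounded_assm P R"
    and "m \<ge> 1" and "block_choice_assm P R m"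
  shows
    "\<forall>i\<in>{1..nblocks P}.
       (\<forall>k\<ge>m.
          (\<forall>l\<in>{1..ncons P i (last_op P \<alpha> R i k)}. last_mult P \<alpha> R i k l \<ge> 0) \<and>
          bpart P i (iter R (k + 1)) \<in> cover P i (last_op P \<alpha> R i k) \<and>
          (\<forall>l\<in>{1..ncons P i (last_op P \<alpha> R i k)}.
             min (last_mult P \<alpha> R i k l)
                 (- con P i (last_op P \<alpha> R i k) l (bpart P i (iter R (k + 1)))) \<le> \<delta>)) \<and>
       (\<lambda>k. residual P \<alpha> R i k) \<longlonglongrightarrow> 0 \<and>
       (\<forall>\<epsilon>>0. \<forall>fbound. (\<forall>k. fbound \<le> obj P (iter R k)) \<longrightarrow>
          finite {k. k \<ge> m \<and> residual P \<alpha> R i k > \<epsilon>} \<and>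
          (\<sigma>min \<le> sigma_max \<alpha> \<gamma> cB \<longrightarrow>
             real (card {k. k \<ge> m \<and> residual P \<alpha> R i k > \<epsilon>})
               \<le> (obj P (iter R 0) - fbound)
                   / (\<alpha> * (\<epsilon> / (c4 cB (sigma_max \<alpha> \<gamma> cB) \<theta> \<gamma> * real m))\<^sup>2)) \<and>
          real (card {k. k \<ge> m \<and> residual P \<alpha> R i k > \<epsilon>})
            \<le> (obj P (iter R 0) - fbound)
                / (\<alpha> * (\<epsilon> / (c4 cB (max \<sigma>min (sigma_max \<alpha> \<gamma> cB)) \<theta> \<gamma> * real m))\<^sup>2))"
proof (intro ballI conjI)
  interpret bcd_convergence P R \<alpha> \<delta> \<theta> \<sigma>min \<gamma> cB
    by unfold_locales (use assms in auto)
  note choice = \<open>block_choice_assm P R m\<close>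
  fix i assume i: "i \<in> {1..nblocks P}"
  show "\<forall>k\<ge>m.
      (\<forall>l\<in>{1..ncons P i (last_op P \<alpha> R i k)}. last_mult P \<alpha> R i k l \<ge> 0) \<and>
      bpart P i (iter R (k + 1)) \<in> cover P i (last_op P \<alpha> R i k) \<and>
      (\<forall>l\<in>{1..ncons P i (last_op P \<alpha> R i k)}.
         min (last_mult P \<alpha> R i k l)
             (- con P i (last_op P \<alpha> R i k) l (bpart P i (iter R (k + 1)))) \<le> \<delta>)"
    using last_multipliers[OF choice i] bpart_in_last_cover[OF choice i] by simp
  show "(\<lambda>k. residual P \<alpha> R i k) \<longlonglongrightarrow> 0"
    by (rule residual_tendsto_zero[OF choice \<open>m \<ge> 1\<close> i \<open>lower_bounded_assm P R\<close>])
  show "\<forall>\<epsilon>>0. \<forall>fbound. (\<forall>k. fbound \<le> obj P (iter R k)) \<longrightarrow>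
      finite {k. k \<ge> m \<and> residual P \<alpha> R i k > \<epsilon>} \<and>
      (\<sigma>min \<le> sigma_max \<alpha> \<gamma> cB \<longrightarrow>
         real (card {k. k \<ge> m \<and> residual P \<alpha> R i k > \<epsilon>})
           \<le> (obj P (iter R 0) - fbound)
               / (\<alpha> * (\<epsilon> / (c4 cB (sigma_max \<alpha> \<gamma> cB) \<theta> \<gamma> * real m))\<^sup>2)) \<and>
      real (card {k. k \<ge> m \<and> residual P \<alpha> R i k > \<epsilon>})
        \<le> (obj P (iter R 0) - fbound)
            / (\<alpha> * (\<epsilon> / (c4 cB (max \<sigma>min (sigma_max \<alpha> \<gamma> cB)) \<theta> \<gamma> * real m))\<^sup>2)"
  proof (intro allI impI)
    fix \<epsilon> fbound :: real assume "\<epsilon> > 0" "\<forall>k. fbound \<le> obj P (iter R k)"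
    then have fin: "finite {k. k \<ge> m \<and> residual P \<alpha> R i k > \<epsilon>}"
      and le: "real (card {k. k \<ge> m \<and> residual P \<alpha> R i k > \<epsilon>})
        \<le> (obj P (iter R 0) - fbound)
            / (\<alpha> * (\<epsilon> / (c4 cB (max \<sigma>min (sigma_max \<alpha> \<gamma> cB)) \<theta> \<gamma> * real m))\<^sup>2)"
      using large_residuals[OF choice \<open>m \<ge> 1\<close> i, of \<epsilon> fbound] by blast+
    (* If \<sigma>min does not exceed sigma_max, the maximum is sigma_max and both bounds coincide. *)
    show "finite {k. k \<ge> m \<and> residual P \<alpha> R i k > \<epsilon>} \<and>
      (\<sigma>min \<le> sigma_max \<alpha> \<gamma> cB \<longrightarrow>
         real (card {k. k \<ge> m \<and> residual P \<alpha> R i k > \<epsilon>})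
           \<le> (obj P (iter R 0) - fbound)
               / (\<alpha> * (\<epsilon> / (c4 cB (sigma_max \<alpha> \<gamma> cB) \<theta> \<gamma> * real m))\<^sup>2)) \<and>
      real (card {k. k \<ge> m \<and> residual P \<alpha> R i k > \<epsilon>})
        \<le> (obj P (iter R 0) - fbound)
            / (\<alpha> * (\<epsilon> / (c4 cB (max \<sigma>min (sigma_max \<alpha> \<gamma> cB)) \<theta> \<gamma> * real m))\<^sup>2)"
      using fin le by (auto simp: max_absorb2)
  qed
qed

end
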